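(* Let $A$ be a closed Hermitian operator in a Hilbert space $H$ and let $\epsilon,\delta,\lambda$ be non-negative real numbers. For a linear operator $T$ in $H$ and $\mu\ge0$ write $$F(T,\mu)=\{x : x\in D(T^n),\ \|T^nx\|\le\mu^n\|x\|\ \text{ for all } n\in\mathbb{N}\}.$$ Then: (i) $F(A,\lambda)$ is a closed linear subspace of $H$ which is left invariant by $A$, i.e. $A(F(A,\lambda))\subset F(A,\lambda)$. (ii) Every bounded linear operator $B$ on $H$ satisfying $BA\subset AB$ maps $F(A,\lambda)$ into itself; similarly, $B^*\bigl(F(A,\lambda)^\perp\bigr)\subset F(A,\lambda)^\perp$. (iii) $F(A+\delta,\epsilon)\subset F(A,\delta+\epsilon)$ and $F(A^2,\epsilon^2)=F(A,\epsilon)$.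
   Context: Hilbert spaces may be real or complex; $\mathbb{N}=\{1,2,\dots\}$. A linear operator $A$ with domain $D(A)\subset H$ is Hermitian if $\langle Ax,y\rangle=\langle x,Ay\rangle$ for all $x,y\in D(A)$; it is not assumed to be densely defined. $A+\delta$ denotes $A+\delta I$ with domain $D(A)$. $BA\subset AB$ means that for every $x\in D(A)$ one has $Bx\in D(A)$ and $ABx=BAx$. *)

theory Defs
  imports "HOL-Analysis.Analysis"
begin

text \<open>
  The models of this class are the real numbers (with the identity) and the complex numbers
  (with complex conjugation); see \<open>rc_field_real_or_complex\<close> below.
\<close>

class rc_field = real_normed_field +
  fixes cconj :: "'a \<Rightarrow> 'a"
  assumes cconj_add: "cconj (x + y) = cconj x + cconj y"
    and mult_cconj_scaleR: "x * cconj x = (norm x)\<^sup>2 *\<^sub>R 1"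

instantiation real :: rc_field
begin
definition cconj_real :: "real \<Rightarrow> real" where "cconj_real x = x"
instance by standard (simp_all add: cconj_real_def power2_eq_square)
end

instantiation complex :: rc_field
begin
definition cconj_complex :: "complex \<Rightarrow> complex" where "cconj_complex z = cnj z"
instance
proof
  fix x y :: complex
  show "cconj (x + y) = cconj x + cconj y" by (simp add: cconj_complex_def)
  show "x * cconj x = (norm x)\<^sup>2 *\<^sub>R 1"
    unfolding cconj_complex_def scaleR_conv_of_real mult_1_right by (metis complex_norm_square)
qed
end

lemma mult_cconj: "x * cconj x = of_real ((norm x)\<^sup>2)" for x :: "'k::rc_field"
  by (simp add: mult_cconj_scaleR scaleR_conv_of_real)

lemma cconj_one: "cconj 1 = (1 :: 'k::rc_field)"
  using mult_cconj[of "1 :: 'k"] by simp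

lemma cconj_zero: "cconj 0 = (0 :: 'k::rc_field)"
  using cconj_add[of "0 :: 'k" 0] by (metis add.right_neutral add_left_cancel)

lemma cconj_minus: "cconj (- x) = - cconj (x :: 'k::rc_field)"
  using cconj_add[of x "- x"] by (metis add.right_inverse cconj_zero minus_unique)

lemma cconj_of_real: "cconj (of_real r :: 'k::rc_field) = of_real r"
proof (cases "r = 0")
  case False
  have "of_real r * cconj (of_real r :: 'k) = of_real r * of_real r"
    using mult_cconj[of "of_real r :: 'k"] by (simp add: power2_eq_square)
  with False show ?thesis by simp
qed (simp add: cconj_zero)

lemma norm_cconj: "norm (cconj x) = norm (x :: 'k::rc_field)"
proof (cases "x = 0")
  case False
  have "norm x * norm (cconj x) = norm x * norm x"
    using arg_cong[OF mult_cconj[of x], of norm]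
    by (simp add: norm_mult power2_eq_square)
  with False show ?thesis by simp
qed (simp add: cconj_zero)

lemma cconj_mult: "cconj (x * y) = cconj x * cconj (y :: 'k::rc_field)"
proof (cases "x * y = 0")
  case False
  have "(x * y) * cconj (x * y) = of_real ((norm x)\<^sup>2) * of_real ((norm y)\<^sup>2)"
    by (simp add: mult_cconj norm_mult power_mult_distrib)
  also have "\<dots> = (x * y) * (cconj x * cconj y)"
    by (simp only: mult_cconj[symmetric] mult_ac)
  finally show ?thesis using False by simp
qed (auto simp: cconj_zero)

lemma add_cconj_Reals: "x + cconj x \<in> \<real>" for x :: "'k::rc_field"
proof -
  have "(1 + x) * cconj (1 + x) = 1 + (x + cconj x) + x * cconj x"
    by (simp add: cconj_add cconj_one algebra_simps)
  then have "x + cconj x = of_real ((norm (1 + x))\<^sup>2 - 1 - (norm x)\<^sup>2)"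
    by (simp add: mult_cconj algebra_simps)
  then show ?thesis by (metis Reals_of_real)
qed

lemma cconj_fixed_Reals: "x \<in> \<real>" if "cconj x = x" for x :: "'k::rc_field"
proof -
  have "(x + cconj x) / 2 \<in> \<real>" using add_cconj_Reals[of x] by (simp add: Reals_divide)
  then show ?thesis using that by simp
qed

lemma rc_field_real_or_complex:
  "(\<forall>x::'k::rc_field. x \<in> \<real>) \<or>
   (\<exists>i::'k. i * i = - 1 \<and> cconj i = - i \<and> (\<forall>x. \<exists>a b. x = of_real a + of_real b * i))"
proof (cases "\<forall>x::'k. x \<in> \<real>")
  case False
  have decomp: "\<exists>a w. x = of_real a + w \<and> cconj w = - w" for x :: 'k
  proof -
    obtain s where s: "x + cconj x = of_real s" using add_cconj_Reals[of x] by (auto elim: Reals_cases)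
    define w where "w = x - of_real (s / 2)"
    have r: "of_real (s / 2) + of_real (s / 2) = (of_real s :: 'k)"
      by (simp flip: of_real_add del: of_real_divide)
    have "cconj w = cconj x - of_real (s / 2)"
      unfolding w_def diff_conv_add_uminus by (simp only: cconj_add cconj_minus cconj_of_real)
    also have "\<dots> = - w"
    proof -
      have "cconj x = of_real (s / 2) + of_real (s / 2) - x"
        using s r by (metis add_diff_cancel_left')
      then show ?thesis by (simp add: w_def del: of_real_divide)
    qed
    finally have "cconj w = - w" .
    moreover have "x = of_real (s / 2) + w" by (simp add: w_def)
    ultimately show ?thesis by blast
  qed
  from False obtain x :: 'k where x: "x \<notin> \<real>" by blast
  obtain a v where v: "x = of_real a + v" "cconj v = - v" using decomp by blast
  have "v \<noteq> 0" using x v by auto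
  define i where "i = v / of_real (norm v)"
  have vv: "v * v = - of_real ((norm v)\<^sup>2)"
    using mult_cconj[of v] by (metis minus_minus mult_minus_right v(2))
  have ii: "i * i = - 1" using \<open>v \<noteq> 0\<close> by (simp add: i_def vv power2_eq_square)
  have "i = v * of_real (inverse (norm v))"
    by (simp add: i_def divide_inverse)
  then have ci: "cconj i = - i"
    using v(2) by (simp only: cconj_mult cconj_of_real mult_minus_left)
  have "\<exists>a b. y = of_real a + of_real b * i" for y :: 'k
  proof -
    obtain a w where w: "y = of_real a + w" "cconj w = - w" using decomp by blast
    have "cconj (w * i) = w * i" by (simp add: cconj_mult w ci)
    then obtain b where b: "w * i = of_real b" using cconj_fixed_Reals by (blast elim: Reals_cases)
    have "w = - (w * i) * i" by (simp add: mult.assoc ii)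
    then have "w = of_real (- b) * i" using b by simp
    then show ?thesis using w by blast
  qed
  then show ?thesis using ii ci by blast
qed blast

text \<open>
  A real or complex Hilbert space: completeness and the norm topology come from the sort
  \<open>banach\<close> of \<open>'h\<close>. The inner product is linear in the first argument.
\<close>

locale hilbert_space = vector_space smul
  for smul :: "'k::rc_field \<Rightarrow> 'h::banach \<Rightarrow> 'h" +
  fixes ip :: "'h \<Rightarrow> 'h \<Rightarrow> 'k"
  assumes scale_of_real: "smul (of_real r) x = r *\<^sub>R x"
    and ip_add_left: "ip (x + y) z = ip x z + ip y z"
    and ip_scale_left: "ip (smul c x) y = c * ip x y"
    and ip_commute: "ip y x = cconj (ip x y)"
    and ip_self: "ip x x = of_real ((norm x)\<^sup>2)"

lemma hilbert_space_real_inner: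
  "hilbert_space (scaleR :: real \<Rightarrow> 'h \<Rightarrow> 'h::{real_inner,banach}) inner"
  by unfold_locales
    (simp_all add: algebra_simps inner_commute cconj_real_def power2_norm_eq_inner)

lemma hilbert_space_complex:
  "hilbert_space ((*) :: complex \<Rightarrow> complex \<Rightarrow> complex) (\<lambda>z w. z * cnj w)"
  by unfold_locales
    (simp_all add: algebra_simps cconj_complex_def scaleR_conv_of_real flip: complex_norm_square)

text \<open>A partially defined operator; the values of \<open>op_app\<close> outside \<open>op_dom\<close> are irrelevant.\<close>

record 'h operator =
  op_dom :: "'h set"
  op_app :: "'h \<Rightarrow> 'h"

definition linear_operator :: "('k::rc_field \<Rightarrow> 'h::banach \<Rightarrow> 'h) \<Rightarrow> 'h operator \<Rightarrow> bool" where
  "linear_operator smul T \<longleftrightarrow>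
     module.subspace smul (op_dom T) \<and>
     (\<forall>x\<in>op_dom T. \<forall>y\<in>op_dom T. op_app T (x + y) = op_app T x + op_app T y) \<and>
     (\<forall>c. \<forall>x\<in>op_dom T. op_app T (smul c x) = smul c (op_app T x))"

definition closed_operator :: "'h::banach operator \<Rightarrow> bool" where
  "closed_operator T \<longleftrightarrow> closed {(x, op_app T x) | x. x \<in> op_dom T}"

definition hermitian :: "('h \<Rightarrow> 'h \<Rightarrow> 'k::rc_field) \<Rightarrow> 'h::banach operator \<Rightarrow> bool" where
  "hermitian ip T \<longleftrightarrow>
     (\<forall>x\<in>op_dom T. \<forall>y\<in>op_dom T. ip (op_app T x) y = ip x (op_app T y))"

definition op_comp :: "'h operator \<Rightarrow> 'h operator \<Rightarrow> 'h operator" where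
  "op_comp S T = \<lparr>op_dom = {x \<in> op_dom T. op_app T x \<in> op_dom S},
                  op_app = (\<lambda>x. op_app S (op_app T x))\<rparr>"

primrec op_power :: "'h operator \<Rightarrow> nat \<Rightarrow> 'h operator" where
  "op_power T 0 = \<lparr>op_dom = UNIV, op_app = (\<lambda>x. x)\<rparr>"
| "op_power T (Suc n) = op_comp T (op_power T n)"

definition op_shift :: "'h::banach operator \<Rightarrow> real \<Rightarrow> 'h operator" where
  "op_shift T d = \<lparr>op_dom = op_dom T, op_app = (\<lambda>x. op_app T x + d *\<^sub>R x)\<rparr>"

definition F :: "'h::banach operator \<Rightarrow> real \<Rightarrow> 'h set" where
  "F T \<mu> = {x. \<forall>n\<ge>1. x \<in> op_dom (op_power T n) \<and>
                   norm (op_app (op_power T n) x) \<le> \<mu> ^ n * norm x}"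

definition bounded_operator :: "('k::rc_field \<Rightarrow> 'h::banach \<Rightarrow> 'h) \<Rightarrow> ('h \<Rightarrow> 'h) \<Rightarrow> bool" where
  "bounded_operator smul B \<longleftrightarrow> Vector_Spaces.linear smul smul B \<and> bounded_linear B"

text \<open>The inclusion \<open>BA \<subseteq> AB\<close> of operators.\<close>

definition commutes_with :: "('h \<Rightarrow> 'h) \<Rightarrow> 'h operator \<Rightarrow> bool" where
  "commutes_with B A \<longleftrightarrow>
     (\<forall>x\<in>op_dom A. B x \<in> op_dom A \<and> op_app A (B x) = B (op_app A x))"

text \<open>The analogue of \<open>adjoint\<close> for an inner product with values in \<open>'k\<close>.\<close>

definition hilbert_adjoint ::
    "('h \<Rightarrow> 'h \<Rightarrow> 'k::rc_field) \<Rightarrow> ('h::banach \<Rightarrow> 'h) \<Rightarrow> ('h \<Rightarrow> 'h)" where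
  "hilbert_adjoint ip B = (SOME C. \<forall>x y. ip (B x) y = ip x (C y))"

definition orth_compl :: "('h \<Rightarrow> 'h \<Rightarrow> 'k::rc_field) \<Rightarrow> 'h::banach set \<Rightarrow> 'h set" where
  "orth_compl ip S = {y. \<forall>x\<in>S. ip x y = 0}"

end

theory Submission
  imports Defs
begin

text \<open>
  For a Hermitian operator the sequence \<open>a\<^sub>n = \<parallel>A\<^sup>n x\<parallel>\<close> is log-convex, because
  \<open>\<parallel>A\<^sup>n\<^sup>+\<^sup>1 x\<parallel>\<^sup>2 = \<langle>A\<^sup>n x, A\<^sup>n\<^sup>+\<^sup>2 x\<rangle>\<close>. Hence the ratios \<open>a\<^sub>n\<^sub>+\<^sub>1 / a\<^sub>n\<close> increase, and a bound
  \<open>a\<^sub>n \<le> C \<mu>\<^sup>n\<close> with an arbitrary constant \<open>C\<close> already forces \<open>a\<^sub>n \<le> \<mu>\<^sup>n a\<^sub>0\<close>. The membership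
  condition with a free constant is visibly stable under sums and under operators that commute
  with \<open>A\<close>. On the subspace \<open>F(A, \<mu>)\<close> the operator is bounded by \<open>\<mu>\<close>, so closedness follows from that
  of \<open>A\<close>; and \<open>A = (A + \<delta>) - \<delta>\<close> is bounded by \<open>\<epsilon> + \<delta>\<close> on the invariant subspace \<open>F(A + \<delta>, \<epsilon>)\<close>.
  The existence of the adjoint is the Riesz representation theorem, proved by minimising
  \<open>\<parallel>x\<parallel>\<^sup>2 - 2 g x\<close>.
\<close>

section \<open>Growth of log-convex sequences\<close>

text \<open>If the first ratio \<open>r = a 1 / a 0\<close> exceeded \<mu>, log-convexity would keep
  all later ratios at least \<open>r\<close>, so \<open>a n\<close> would dominate
  \<open>a 0 * r ^ n\<close> and outgrow \<open>C * \<mu> ^ n\<close>, however large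
  \<open>C\<close> is.\<close>

lemma log_convex_ratio_le:
  fixes a :: "nat \<Rightarrow> real"
  assumes nn: "\<And>n. a n \<ge> 0"
    and lc: "\<And>n. (a (Suc n))\<^sup>2 \<le> a n * a (Suc (Suc n))"
    and bd: "\<And>n. a n \<le> C * \<mu> ^ n" and "\<mu> \<ge> 0"
  shows "a 1 \<le> \<mu> * a 0"
proof (rule ccontr)
  assume "\<not> ?thesis"
  then have gt: "\<mu> * a 0 < a 1" by simp
  \<comment> \<open>Log-convexity at index 0 turns \<open>a 0 = 0\<close> into
    \<open>a 1 = 0\<close>, against \<open>gt\<close>.\<close>
  have "a 0 \<noteq> 0" using lc[of 0] gt by auto
  then have a0: "a 0 > 0" using nn[of 0] by simp
  have a1: "a 1 > 0" using gt a0 \<open>\<mu> \<ge> 0\<close> by (smt (verit) mult_nonneg_nonneg)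
  define r where "r = a 1 / a 0"
  have r: "r > \<mu>" "r > 0" using gt a0 a1 by (simp_all add: r_def field_simps)
  have step: "a n > 0 \<and> a (Suc n) \<ge> r * a n" for n
  proof (induction n)
    case 0
    then show ?case using a0 by (simp add: r_def)
  next
    case (Suc n)
    have p: "a (Suc n) > 0" using Suc r(2) by (smt (verit) mult_pos_pos)
    \<comment> \<open>The factor \<open>a n\<close> is positive by the induction hypothesis and
      cancels at the end.\<close>
    have "a n * (r * a (Suc n)) \<le> a (Suc n) * a (Suc n)"
      using Suc p by (simp add: mult.assoc mult.left_commute mult.commute)
    also have "\<dots> \<le> a n * a (Suc (Suc n))" using lc[of n] by (simp add: power2_eq_square)
    finally show ?case using Suc p by simp
  qed
  have grow: "a 0 * r ^ n \<le> a n" for n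
  proof (induction n)
    case (Suc n)
    have "a 0 * r ^ Suc n \<le> r * a n" using Suc r(2) by simp
    then show ?case using step[of n] by linarith
  qed simp
  show False
  proof (cases "\<mu> = 0")
    case True
    then show False using bd[of 1] a1 by simp
  next
    case False
    then have "\<mu> > 0" using \<open>\<mu> \<ge> 0\<close> by simp
    then have "1 < r / \<mu>" using r by simp
    then obtain n where n: "C / a 0 < (r / \<mu>) ^ n" using real_arch_pow by blast
    have "a 0 * r ^ n \<le> C * \<mu> ^ n" using grow[of n] bd[of n] by simp
    then have "(r / \<mu>) ^ n \<le> C / a 0"
      using a0 \<open>\<mu> > 0\<close> by (simp add: power_divide field_simps)
    with n show False by simp
  qed
qed

section \<open>Operator powers and membership in \<open>F\<close>\<close>

lemma op_app_power: "op_app (op_power T n) x = (op_app T ^^ n) x"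
  by (induction n) (simp_all add: op_comp_def)

lemma op_dom_power: "x \<in> op_dom (op_power T n) \<longleftrightarrow> (\<forall>k<n. (op_app T ^^ k) x \<in> op_dom T)"
  by (induction n) (auto simp: op_comp_def op_app_power less_Suc_eq)

text \<open>Index 0 comes for free in the norm bound. The domain condition on the
  \<open>n\<close>-th iterate is read off from the power \<open>Suc n\<close>.\<close>

lemma F_iff:
  "x \<in> F T \<mu> \<longleftrightarrow>
     (\<forall>n. (op_app T ^^ n) x \<in> op_dom T \<and> norm ((op_app T ^^ n) x) \<le> \<mu> ^ n * norm x)"
proof
  assume x: "x \<in> F T \<mu>"
  show "\<forall>n. (op_app T ^^ n) x \<in> op_dom T \<and> norm ((op_app T ^^ n) x) \<le> \<mu> ^ n * norm x"
  proof
    fix n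
    have "(op_app T ^^ n) x \<in> op_dom T"
      proof -
      have "x \<in> op_dom (op_power T (Suc n))"
        using x unfolding F_def by (auto simp del: op_power.simps)
      then show ?thesis unfolding op_dom_power by simp
    qed
    moreover have "norm ((op_app T ^^ n) x) \<le> \<mu> ^ n * norm x"
      using x by (cases "n = 0") (simp_all add: F_def op_app_power)
    ultimately show "(op_app T ^^ n) x \<in> op_dom T \<and> norm ((op_app T ^^ n) x) \<le> \<mu> ^ n * norm x"
      by simp
  qed
qed (simp add: F_def op_app_power op_dom_power)

text \<open>A one-step bound iterates on an invariant set. The intended \<open>V\<close> is the
  space \<open>F\<close> of a shifted operator.\<close>

lemma subset_F_if_invariant:
  assumes dom: "V \<subseteq> op_dom T" and inv: "op_app T ` V \<subseteq> V"
    and bd: "\<And>x. x \<in> V \<Longrightarrow> norm (op_app T x) \<le> \<mu> * norm x" and "\<mu> \<ge> 0"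
  shows "V \<subseteq> F T \<mu>"
proof
  fix x assume x: "x \<in> V"
  have "(op_app T ^^ n) x \<in> V \<and> norm ((op_app T ^^ n) x) \<le> \<mu> ^ n * norm x" for n
  proof (induction n)
    case (Suc n)
    have "norm (op_app T ((op_app T ^^ n) x)) \<le> \<mu> * norm ((op_app T ^^ n) x)"
      using bd Suc by simp
    also have "\<dots> \<le> \<mu> * (\<mu> ^ n * norm x)" using Suc \<open>\<mu> \<ge> 0\<close> by (simp add: mult_left_mono)
    finally show ?case using inv Suc by auto
  qed (simp add: x)
  then show "x \<in> F T \<mu>" using dom by (auto simp: F_iff)
qed

text \<open>The real part of the inner product, expressed through the norm.\<close>

definition re_ip :: "'h::real_normed_vector \<Rightarrow> 'h \<Rightarrow> real" where
  "re_ip x y = ((norm (x + y))\<^sup>2 - (norm x)\<^sup>2 - (norm y)\<^sup>2) / 2"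

lemma re_ip_commute: "re_ip x y = re_ip y x"
  by (simp add: re_ip_def add.commute)

lemma re_ip_self: "re_ip x x = (norm x)\<^sup>2"
  unfolding re_ip_def scaleR_2[symmetric] norm_scaleR by (simp add: power_mult_distrib)

lemma re_ip_le: "re_ip x y \<le> norm x * norm y"
proof -
  have "(norm (x + y))\<^sup>2 \<le> (norm x + norm y)\<^sup>2" by (simp add: norm_triangle_ineq power_mono)
  then show ?thesis by (simp add: re_ip_def power2_sum)
qed

lemma norm_add_sq: "(norm (x + y))\<^sup>2 = (norm x)\<^sup>2 + 2 * re_ip x y + (norm y)\<^sup>2"
  by (simp add: re_ip_def field_simps)

section \<open>Inner product and norm identities\<close>

context hilbert_space
begin

lemma ip_add_right: "ip x (y + z) = ip x y + ip x z"
  by (metis cconj_add ip_add_left ip_commute)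

text \<open>The bridge between \<open>ip\<close> and \<open>re_ip\<close>: identities for
  \<open>ip\<close> descend to real ones because \<open>of_real\<close> is injective, uniformly for
  real and complex scalars.\<close>

lemma of_real_re_ip: "of_real (2 * re_ip x y) = ip x y + ip y x"
proof -
  have "ip (x + y) (x + y) = ip x x + (ip x y + ip y x) + ip y y"
    by (simp add: ip_add_left ip_add_right)
  then have "ip x y + ip y x = of_real ((norm (x + y))\<^sup>2 - (norm x)\<^sup>2 - (norm y)\<^sup>2)"
    by (simp add: ip_self algebra_simps)
  then show ?thesis by (simp add: re_ip_def)
qed

lemma re_ip_add_left: "re_ip (x + y) z = re_ip x z + re_ip y z" for x y z :: 'h
proof -
  have "of_real (2 * re_ip (x + y) z) = (of_real (2 * re_ip x z + 2 * re_ip y z) :: 'k)"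
    unfolding of_real_add of_real_re_ip by (simp add: ip_add_left ip_add_right)
  then show ?thesis unfolding of_real_eq_iff by simp
qed

lemma ip_scaleR_left: "ip (r *\<^sub>R x) y = of_real r * ip x y"
  using ip_scale_left[of "of_real r"] by (simp add: scale_of_real)

lemma ip_scaleR_right: "ip x (r *\<^sub>R y) = of_real r * ip x y"
  by (metis cconj_mult cconj_of_real ip_commute ip_scaleR_left)

lemma re_ip_scaleR_left: "re_ip (r *\<^sub>R x) y = r * re_ip x y" for x y :: 'h
proof -
  have "of_real (2 * re_ip (r *\<^sub>R x) y) = of_real r * (of_real (2 * re_ip x y) :: 'k)"
    unfolding of_real_re_ip by (simp add: ip_scaleR_left ip_scaleR_right algebra_simps)
  then show ?thesis unfolding of_real_mult[symmetric] of_real_eq_iff by simp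
qed

lemma abs_re_ip_le: "\<bar>re_ip x y\<bar> \<le> norm x * norm y" for x y :: 'h
  using re_ip_le[of x y] re_ip_le[of "- x" y] re_ip_scaleR_left[of "- 1" x y] by simp

lemma norm_smul: "norm (smul c x) = norm c * norm x"
proof -
  have "of_real ((norm (smul c x))\<^sup>2) = c * (cconj c * ip x x)"
    by (metis cconj_mult ip_commute ip_scale_left ip_self)
  also have "\<dots> = (of_real ((norm c * norm x)\<^sup>2) :: 'k)"
    by (simp add: mult.assoc[symmetric] mult_cconj ip_self power_mult_distrib)
  finally have "(norm (smul c x))\<^sup>2 = (norm c * norm x)\<^sup>2" unfolding of_real_eq_iff .
  then show ?thesis by (simp add: power2_eq_iff_nonneg)
qed

lemma parallelogram: "(norm (x + y))\<^sup>2 + (norm (x - y))\<^sup>2 = 2 * (norm x)\<^sup>2 + 2 * (norm y)\<^sup>2"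
  for x y :: 'h
proof -
  have "re_ip x (- y) = - re_ip x y"
    using re_ip_scaleR_left[of "- 1" y x] by (simp add: re_ip_commute)
  then show ?thesis using norm_add_sq[of x y] norm_add_sq[of x "- y"] by simp
qed

section \<open>Riesz representation and the adjoint\<close>

lemma riesz_re_ip:
  fixes g :: "'h \<Rightarrow> real"
  assumes "bounded_linear g"
  shows "\<exists>u. \<forall>h. g h = re_ip h u"
proof -
  interpret g: bounded_linear g by fact
  obtain M where M: "\<And>x. norm (g x) \<le> norm x * M" using g.bounded by blast
  define J where "J x = (norm x)\<^sup>2 - 2 * g x" for x
  have Jlb: "- M\<^sup>2 \<le> J x" for x
  proof -
    have "0 \<le> (norm x - M)\<^sup>2" by simp
    then show ?thesis using M[of x] by (simp add: J_def power2_diff abs_le_iff)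
  qed
  define m where "m = (INF x. J x)"
  have bdd: "bdd_below (range J)" using Jlb by (auto intro!: bdd_belowI)
  have mle: "m \<le> J x" for x unfolding m_def using bdd by (simp add: cINF_lower)
  have "\<exists>x. J x < m + inverse (real (Suc n))" for n
    using cINF_less_iff[OF _ bdd, of "m + inverse (real (Suc n))"] by (auto simp: m_def)
  then obtain X where X: "\<And>n. J (X n) < m + inverse (real (Suc n))" by metis
  \<comment> \<open>The parallelogram law gives equality with \<open>J\<close> of the midpoint in
    place of \<open>m\<close>; the midpoint value is at least \<open>m\<close>. Hence minimising
    sequences are Cauchy.\<close>
  have dist: "(norm (x - y))\<^sup>2 \<le> 2 * (J x + J y - 2 * m)" for x y
  proof -
    have n: "norm ((1/2) *\<^sub>R (x + y)) = norm (x + y) / 2" by (simp only: norm_scaleR)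
    have "J ((1/2) *\<^sub>R (x + y)) = (norm (x + y))\<^sup>2 / 4 - (g x + g y)"
      unfolding J_def n g.scaleR g.add by (simp add: power_divide field_simps)
    then show ?thesis using mle[of "(1/2) *\<^sub>R (x + y)"] parallelogram[of x y]
      by (simp add: J_def)
  qed
  have JX: "(\<lambda>n. J (X n)) \<longlonglongrightarrow> m"
  proof (rule tendsto_sandwich[of "\<lambda>_. m"])
    show "(\<lambda>n. m + inverse (real (Suc n))) \<longlonglongrightarrow> m"
      using tendsto_add[OF tendsto_const LIMSEQ_inverse_real_of_nat, of m] by simp
  qed (use less_imp_le[OF X] mle in \<open>simp_all del: of_nat_Suc\<close>)
  have "Cauchy X"
  proof (rule CauchyI)
    fix e :: real assume "e > 0"
    then obtain N where N: "\<And>n. n \<ge> N \<Longrightarrow> norm (J (X n) - m) < e\<^sup>2 / 4"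
      using LIMSEQ_D[OF JX, of "e\<^sup>2 / 4"] by auto
    have "norm (X i - X j) < e" if "i \<ge> N" "j \<ge> N" for i j
    proof (rule power2_less_imp_less)
      show "(norm (X i - X j))\<^sup>2 < e\<^sup>2"
        using dist[of "X i" "X j"] N[OF that(1)] N[OF that(2)] unfolding real_norm_def abs_less_iff by (auto simp: algebra_simps)
    qed (use \<open>e > 0\<close> in simp)
    then show "\<exists>N. \<forall>i\<ge>N. \<forall>j\<ge>N. norm (X i - X j) < e" by blast
  qed
  then obtain u where u: "X \<longlonglongrightarrow> u" using Cauchy_convergent convergent_def by blast
  have "(\<lambda>n. J (X n)) \<longlonglongrightarrow> J u"
    unfolding J_def by (intro tendsto_intros u g.tendsto)
  then have Ju: "J u = m" using JX LIMSEQ_unique by blast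
  have "g h = re_ip h u" for h
  proof -
    \<comment> \<open>Half the derivative of \<open>J\<close> at the minimiser \<open>u\<close> in
      direction \<open>h\<close>.\<close>
    define c where "c = re_ip h u - g h"
    have pos: "0 \<le> 2 * t * c + t\<^sup>2 * (norm h)\<^sup>2" for t
    proof -
      have "J (u + t *\<^sub>R h) = J u + 2 * t * c + t\<^sup>2 * (norm h)\<^sup>2"
        unfolding J_def norm_add_sq re_ip_commute[of u] re_ip_scaleR_left c_def
        by (simp add: g.add g.scaleR power_mult_distrib algebra_simps)
      then show ?thesis using mle[of "u + t *\<^sub>R h"] Ju by simp
    qed
    have "c = 0"
    proof (cases "h = 0")
      case True
      then show ?thesis using re_ip_scaleR_left[of 0 0 u] by (simp add: c_def g.zero)
    next
      case False
      \<comment> \<open>The chosen \<open>t\<close> minimises the quadratic in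
        \<open>pos\<close>.\<close>
      then have "0 \<le> - (c\<^sup>2 / (norm h)\<^sup>2)"
        using pos[of "- c / (norm h)\<^sup>2"] by (simp add: field_simps power2_eq_square)
      then have "c\<^sup>2 / (norm h)\<^sup>2 \<le> 0" by simp
      then show ?thesis using False by (simp add: divide_le_0_iff)
    qed
    then show ?thesis by (simp add: c_def)
  qed
  then show ?thesis by blast
qed

text \<open>Riesz for the real part of \<open>ip (B x) y\<close> yields a candidate
  \<open>u\<close>. The defect \<open>d\<close> then has zero real part everywhere, and being
  homogeneous over the full scalar field it must vanish.\<close>

lemma hilbert_adjoint:
  assumes "bounded_operator smul B"
  shows "ip (B x) y = ip x (hilbert_adjoint ip B y)"
proof -
  have lin: "Vector_Spaces.linear smul smul B" and bl: "bounded_linear B"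
    using assms by (simp_all add: bounded_operator_def)
  interpret B: bounded_linear B by fact
  obtain K where K: "\<And>x. norm (B x) \<le> norm x * K" using B.bounded by blast
  have "\<exists>u. \<forall>x. ip (B x) y = ip x u" for y
  proof -
    have "bounded_linear (\<lambda>x. re_ip (B x) y)"
    proof (rule bounded_linear_intro)
      fix x
      have "\<bar>re_ip (B x) y\<bar> \<le> norm (B x) * norm y" by (rule abs_re_ip_le)
      also have "\<dots> \<le> norm x * K * norm y" using K[of x] by (simp add: mult_right_mono)
      finally show "norm (re_ip (B x) y) \<le> norm x * (K * norm y)" by (simp add: mult.assoc)
    qed (simp_all add: B.add B.scaleR re_ip_add_left re_ip_scaleR_left)
    from riesz_re_ip[OF this] obtain u where u: "\<And>x. re_ip (B x) y = re_ip x u" by blast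
    define d where "d x = ip (B x) y - ip x u" for x
    have re0: "d x + cconj (d x) = 0" for x
    proof -
      have "cconj (d x) = ip y (B x) - ip u x"
        unfolding d_def diff_conv_add_uminus cconj_add cconj_minus by (metis ip_commute)
      then have "d x + cconj (d x) = of_real (2 * re_ip (B x) y) - of_real (2 * re_ip x u)"
        unfolding of_real_re_ip by (simp add: d_def)
      then show ?thesis by (simp add: u)
    qed
    have scale: "d (smul c x) = c * d x" for c x
      using module_hom.scale[OF lin[unfolded Vector_Spaces.linear_iff_module_hom]]
      by (simp add: d_def ip_scale_left right_diff_distrib)
    have "d x = 0" for x
    proof -
      \<comment> \<open>Rotating the argument makes the value of \<open>d\<close> real.\<close>
      have r: "d (smul (cconj (d x)) x) = of_real ((norm (d x))\<^sup>2)"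
        unfolding scale by (metis mult.commute mult_cconj)
      have "of_real (2 * (norm (d x))\<^sup>2) = (0 :: 'k)"
        using re0[of "smul (cconj (d x)) x"] unfolding r cconj_of_real by simp
      then show ?thesis unfolding of_real_eq_0_iff by simp
    qed
    then show ?thesis by (auto simp: d_def)
  qed
  then have "\<exists>C. \<forall>x y. ip (B x) y = ip x (C y)" by metis
  from someI_ex[OF this] show ?thesis unfolding hilbert_adjoint_def by blast
qed

section \<open>The spaces \<open>F\<close> of a Hermitian operator\<close>

context
  fixes T :: "'h operator"
  assumes lin: "linear_operator smul T" and herm: "hermitian ip T"
begin

lemma dom_add: "x \<in> op_dom T \<Longrightarrow> y \<in> op_dom T \<Longrightarrow> x + y \<in> op_dom T"
  and dom_smul: "x \<in> op_dom T \<Longrightarrow> smul c x \<in> op_dom T"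
  and dom_zero: "0 \<in> op_dom T"
  using lin by (auto simp: linear_operator_def subspace_add subspace_scale subspace_0)

lemma app_add: "x \<in> op_dom T \<Longrightarrow> y \<in> op_dom T \<Longrightarrow> op_app T (x + y) = op_app T x + op_app T y"
  and app_smul: "x \<in> op_dom T \<Longrightarrow> op_app T (smul c x) = smul c (op_app T x)"
  using lin by (auto simp: linear_operator_def)

lemma app_zero: "op_app T 0 = 0"
  using app_smul[OF dom_zero, of 0] by simp

lemma app_diff: "op_app T (x - y) = op_app T x - op_app T y"
  if "x \<in> op_dom T" "y \<in> op_dom T"
  using app_add[OF that(1) dom_smul[OF that(2)], of "- 1"] app_smul[OF that(2), of "- 1"] by simp

lemma funpow_app_add:
  assumes "\<And>n. (op_app T ^^ n) x \<in> op_dom T" "\<And>n. (op_app T ^^ n) y \<in> op_dom T"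
  shows "(op_app T ^^ n) (x + y) = (op_app T ^^ n) x + (op_app T ^^ n) y"
  by (induction n) (simp_all add: app_add assms)

lemma funpow_app_smul:
  assumes "\<And>n. (op_app T ^^ n) x \<in> op_dom T"
  shows "(op_app T ^^ n) (smul c x) = smul c ((op_app T ^^ n) x)"
  by (induction n) (simp_all add: app_smul assms)

lemma norm_app_sq_le:
  assumes "x \<in> op_dom T" "op_app T x \<in> op_dom T"
  shows "(norm (op_app T x))\<^sup>2 \<le> norm x * norm (op_app T (op_app T x))"
proof -
  \<comment> \<open>Both orders are needed, since \<open>re_ip\<close> is half of the symmetrised
    \<open>ip\<close>.\<close>
  have "ip (op_app T x) (op_app T x) = ip x (op_app T (op_app T x))"
    and "ip (op_app T x) (op_app T x) = ip (op_app T (op_app T x)) x"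
    using herm assms by (auto simp: hermitian_def)
  then have "of_real (2 * re_ip (op_app T x) (op_app T x))
      = (of_real (2 * re_ip x (op_app T (op_app T x))) :: 'k)"
    unfolding of_real_re_ip by simp
  then have "(norm (op_app T x))\<^sup>2 = re_ip x (op_app T (op_app T x))"
    unfolding of_real_eq_iff by (simp add: re_ip_self)
  then show ?thesis using re_ip_le by simp
qed

text \<open>The working criterion for membership: a constant \<open>C\<close> unrelated to
  \<open>norm x\<close> suffices, so closure properties of \<open>F\<close> only need crude
  estimates.\<close>

lemma F_if_bound:
  assumes dom: "\<And>n. (op_app T ^^ n) x \<in> op_dom T"
    and bd: "\<And>n. norm ((op_app T ^^ n) x) \<le> C * \<mu> ^ n" and "\<mu> \<ge> 0"
  shows "x \<in> F T \<mu>"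
proof -
  have step: "norm ((op_app T ^^ Suc k) x) \<le> \<mu> * norm ((op_app T ^^ k) x)" for k
  proof -
    \<comment> \<open>Starting the orbit at the \<open>k\<close>-th iterate bounds the ratio at
      \<open>k\<close>; the constant becomes \<open>C * \<mu> ^ k\<close>.\<close>
    define a where "a n = norm ((op_app T ^^ (n + k)) x)" for n
    have "a 1 \<le> \<mu> * a 0"
    proof (rule log_convex_ratio_le)
      show "(a (Suc n))\<^sup>2 \<le> a n * a (Suc (Suc n))" for n
        using norm_app_sq_le[OF dom[of "n + k"]] dom[of "Suc (n + k)"] by (simp add: a_def)
      show "a n \<le> (C * \<mu> ^ k) * \<mu> ^ n" for n
        using bd[of "n + k"] by (simp add: a_def power_add ac_simps)
    qed (simp_all add: a_def \<open>\<mu> \<ge> 0\<close>)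
    then show ?thesis by (simp add: a_def)
  qed
  have "norm ((op_app T ^^ n) x) \<le> \<mu> ^ n * norm x" for n
  proof (induction n)
    case (Suc n)
    have "norm ((op_app T ^^ Suc n) x) \<le> \<mu> * norm ((op_app T ^^ n) x)" by (rule step)
    also have "\<dots> \<le> \<mu> * (\<mu> ^ n * norm x)" using Suc \<open>\<mu> \<ge> 0\<close> by (rule mult_left_mono)
    finally show ?case by (simp add: mult.assoc)
  qed simp
  then show ?thesis using dom by (simp add: F_iff)
qed

lemma subspace_F:
  assumes "\<mu> \<ge> 0"
  shows "subspace (F T \<mu>)"
proof (rule subspaceI)
  have "(op_app T ^^ n) 0 = 0" for n by (induction n) (simp_all add: app_zero)
  then show "0 \<in> F T \<mu>" by (simp add: F_iff dom_zero)
next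
  fix x y assume xy: "x \<in> F T \<mu>" "y \<in> F T \<mu>"
  then have add: "(op_app T ^^ n) (x + y) = (op_app T ^^ n) x + (op_app T ^^ n) y" for n
    by (intro funpow_app_add) (auto simp: F_iff)
  show "x + y \<in> F T \<mu>"
  proof (rule F_if_bound)
    show "norm ((op_app T ^^ n) (x + y)) \<le> (norm x + norm y) * \<mu> ^ n" for n
    proof -
      have "norm ((op_app T ^^ n) x) \<le> \<mu> ^ n * norm x" "norm ((op_app T ^^ n) y) \<le> \<mu> ^ n * norm y"
        using xy by (auto simp: F_iff)
      then show ?thesis unfolding add
        using norm_triangle_ineq[of "(op_app T ^^ n) x" "(op_app T ^^ n) y"]
        by (simp add: algebra_simps)
    qed
  qed (use xy assms in \<open>auto simp: F_iff add intro: dom_add\<close>)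
next
  fix c x assume x: "x \<in> F T \<mu>"
  then have sc: "(op_app T ^^ n) (smul c x) = smul c ((op_app T ^^ n) x)" for n
    by (intro funpow_app_smul) (auto simp: F_iff)
  show "smul c x \<in> F T \<mu>"
  proof (rule F_if_bound)
    show "norm ((op_app T ^^ n) (smul c x)) \<le> (norm c * norm x) * \<mu> ^ n" for n
    proof -
      have "norm ((op_app T ^^ n) x) \<le> \<mu> ^ n * norm x" using x by (auto simp: F_iff)
      then have "norm c * norm ((op_app T ^^ n) x) \<le> norm c * (\<mu> ^ n * norm x)"
        by (rule mult_left_mono) simp
      then show ?thesis unfolding sc norm_smul by (simp add: ac_simps)
    qed
  qed (use x assms in \<open>auto simp: F_iff sc intro: dom_smul\<close>)
qed

lemma F_dom: "x \<in> F T \<mu> \<Longrightarrow> x \<in> op_dom T"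
  and F_norm: "x \<in> F T \<mu> \<Longrightarrow> norm (op_app T x) \<le> \<mu> * norm x"
  unfolding F_iff by (drule spec[of _ 0], simp, drule spec[of _ 1], simp)

lemma F_invariant:
  assumes "\<mu> \<ge> 0" "x \<in> F T \<mu>"
  shows "op_app T x \<in> F T \<mu>"
proof (rule F_if_bound)
  have sw: "(op_app T ^^ n) (op_app T x) = (op_app T ^^ Suc n) x" for n
    by (simp add: funpow_swap1)
  show "(op_app T ^^ n) (op_app T x) \<in> op_dom T" for n
    unfolding sw using assms(2) F_iff by blast
  show "norm ((op_app T ^^ n) (op_app T x)) \<le> (\<mu> * norm x) * \<mu> ^ n" for n
    unfolding sw using assms(2)[unfolded F_iff, rule_format, of "Suc n"]
    by (simp add: ac_simps)
qed fact

text \<open>On \<open>F T \<mu>\<close> the operator is Lipschitz, so images of a convergent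
  sequence converge, and the closed graph identifies their limit. Invariance of
  \<open>F T \<mu>\<close> lets this be repeated for every iterate.\<close>

lemma closed_F:
  assumes cl: "closed_operator T" and "\<mu> \<ge> 0"
  shows "closed (F T \<mu>)"
  unfolding closed_sequential_limits
proof (intro allI impI)
  have lip: "\<mu>-lipschitz_on (F T \<mu>) (op_app T)"
  proof (rule lipschitz_onI)
    fix x y assume xy: "x \<in> F T \<mu>" "y \<in> F T \<mu>"
    then have "norm (op_app T (x - y)) \<le> \<mu> * norm (x - y)"
      by (intro F_norm subspace_diff[OF subspace_F] \<open>\<mu> \<ge> 0\<close>)
    then show "dist (op_app T x) (op_app T y) \<le> \<mu> * dist x y"
      using xy by (simp add: dist_norm app_diff F_dom)
  qed fact
  have lim: "x \<in> op_dom T \<and> (\<lambda>k. op_app T (X k)) \<longlonglongrightarrow> op_app T x"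
    if X: "\<And>k. X k \<in> F T \<mu>" "X \<longlonglongrightarrow> x" for X :: "nat \<Rightarrow> 'h" and x
  proof -
    have "Cauchy (\<lambda>k. op_app T (X k))"
      using uniformly_continuous_on_Cauchy[OF lipschitz_on_uniformly_continuous[OF lip]
          LIMSEQ_imp_Cauchy[OF X(2)]] X(1) by blast
    then obtain y where y: "(\<lambda>k. op_app T (X k)) \<longlonglongrightarrow> y"
      using Cauchy_convergent convergent_def by blast
    have "(x, y) \<in> {(x, op_app T x) | x. x \<in> op_dom T}"
      by (rule closed_sequentially[OF cl[unfolded closed_operator_def]])
        (use X(1) F_dom tendsto_Pair[OF X(2) y] in auto)
    then show ?thesis using y by auto
  qed
  fix X x assume "(\<forall>k. X k \<in> F T \<mu>) \<and> X \<longlonglongrightarrow> x"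
  then have X: "\<And>k. X k \<in> F T \<mu>" "X \<longlonglongrightarrow> x" by auto
  have it: "(op_app T ^^ n) (X k) \<in> F T \<mu>" for n k
    by (induction n) (simp_all add: X F_invariant \<open>\<mu> \<ge> 0\<close>)
  have conv: "(\<lambda>k. (op_app T ^^ n) (X k)) \<longlonglongrightarrow> (op_app T ^^ n) x" for n
    by (induction n) (use X lim[OF it] in simp_all)
  have "norm ((op_app T ^^ n) x) \<le> \<mu> ^ n * norm x" for n
  proof (rule LIMSEQ_le)
    show "(\<lambda>k. norm ((op_app T ^^ n) (X k))) \<longlonglongrightarrow> norm ((op_app T ^^ n) x)"
      by (intro tendsto_intros conv)
    show "(\<lambda>k. \<mu> ^ n * norm (X k)) \<longlonglongrightarrow> \<mu> ^ n * norm x"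
      by (intro tendsto_intros X)
    show "\<exists>N. \<forall>k\<ge>N. norm ((op_app T ^^ n) (X k)) \<le> \<mu> ^ n * norm (X k)"
      using X(1) by (auto simp: F_iff)
  qed
  then show "x \<in> F T \<mu>" using lim[OF it conv] by (simp add: F_iff)
qed

text \<open>\<open>B\<close> passes through all iterates, so its bound \<open>K\<close> enters only
  once, in the constant \<open>norm x * K\<close>.\<close>

lemma commutes_with_F:
  assumes "bounded_linear B" and com: "commutes_with B T" and "\<mu> \<ge> 0" and x: "x \<in> F T \<mu>"
  shows "B x \<in> F T \<mu>"
proof -
  obtain K where K: "K > 0" "\<And>x. norm (B x) \<le> norm x * K"
    using bounded_linear.pos_bounded[OF assms(1)] by blast
  have it: "(op_app T ^^ n) (B x) = B ((op_app T ^^ n) x)" for n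
    by (induction n) (use com x in \<open>auto simp: commutes_with_def F_iff\<close>)
  show ?thesis
  proof (rule F_if_bound)
    show "(op_app T ^^ n) (B x) \<in> op_dom T" for n
      unfolding it using com x by (auto simp: commutes_with_def F_iff)
    show "norm ((op_app T ^^ n) (B x)) \<le> (norm x * K) * \<mu> ^ n" for n
    proof -
      have "norm ((op_app T ^^ n) x) * K \<le> (\<mu> ^ n * norm x) * K"
        using x K(1) by (simp add: F_iff)
      then show ?thesis unfolding it using K(2)[of "(op_app T ^^ n) x"]
        by (simp add: ac_simps)
    qed
  qed fact
qed

text \<open>The square controls only the even iterates of \<open>T\<close>; each odd one is bounded
  by the geometric mean of its two even neighbours.\<close>

lemma F_square:
  assumes "\<mu> \<ge> 0"
  shows "F (op_power T 2) (\<mu>\<^sup>2) = F T \<mu>"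
proof -
  have sq: "op_app (op_power T 2) ^^ n = op_app T ^^ (2 * n)" for n
  proof -
    have "op_app (op_power T 2) = op_app T ^^ 2" by (rule ext) (rule op_app_power)
    then show ?thesis by (simp add: funpow_mult)
  qed
  have dom: "y \<in> op_dom (op_power T 2) \<longleftrightarrow> y \<in> op_dom T \<and> op_app T y \<in> op_dom T" for y
    by (auto simp: op_dom_power less_2_cases_iff)
  show ?thesis
  proof
    show "F T \<mu> \<subseteq> F (op_power T 2) (\<mu>\<^sup>2)"
    proof
      fix x assume x: "x \<in> F T \<mu>"
      show "x \<in> F (op_power T 2) (\<mu>\<^sup>2)"
        unfolding F_iff sq dom power_mult[symmetric]
        using x[unfolded F_iff] by (metis funpow.simps(2) o_apply)
    qed
  next
    show "F (op_power T 2) (\<mu>\<^sup>2) \<subseteq> F T \<mu>"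
    proof
      fix x assume x: "x \<in> F (op_power T 2) (\<mu>\<^sup>2)"
      define f where "f n = (op_app T ^^ n) x" for n
      have f: "f (2 * n) \<in> op_dom T" "f (Suc (2 * n)) \<in> op_dom T"
        "norm (f (2 * n)) \<le> \<mu> ^ (2 * n) * norm x" for n
        using x by (auto simp: F_iff sq dom f_def power_mult)
      have odd: "norm (f (Suc (2 * n))) \<le> \<mu> ^ Suc (2 * n) * norm x" for n
      proof (rule power2_le_imp_le)
        have "(norm (f (Suc (2 * n))))\<^sup>2 \<le> norm (f (2 * n)) * norm (f (2 * Suc n))"
          using norm_app_sq_le[OF f(1)] f(2)[of n] by (simp add: f_def)
        also have "\<dots> \<le> (\<mu> ^ (2 * n) * norm x) * (\<mu> ^ (2 * Suc n) * norm x)"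
          using assms by (intro mult_mono f) auto
        also have "\<dots> = (\<mu> ^ Suc (2 * n) * norm x)\<^sup>2"
          by (simp add: power2_eq_square algebra_simps)
        finally show "(norm (f (Suc (2 * n))))\<^sup>2 \<le> (\<mu> ^ Suc (2 * n) * norm x)\<^sup>2" .
      qed (use assms in simp)
      have "f n \<in> op_dom T \<and> norm (f n) \<le> \<mu> ^ n * norm x" for n
        using f odd by (cases "even n") (auto elim!: evenE oddE simp del: power_Suc)
      then show "x \<in> F T \<mu>" by (simp add: F_iff f_def)
    qed
  qed
qed

end

section \<open>Real shifts of the operator\<close>

lemma linear_operator_shift:
  assumes "linear_operator smul T"
  shows "linear_operator smul (op_shift T d)"
proof -
  have "d *\<^sub>R smul c x = smul c (d *\<^sub>R x)" for c x
    by (simp add: scale_of_real[symmetric] mult.commute)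
  then show ?thesis
    using assms by (simp add: linear_operator_def op_shift_def scaleR_add_right scale_right_distrib)
qed

lemma hermitian_shift:
  assumes "hermitian ip T"
  shows "hermitian ip (op_shift T d)"
  using assms
  by (simp add: hermitian_def op_shift_def ip_add_left ip_add_right ip_scaleR_left ip_scaleR_right)

text \<open>The space of the shifted operator is a subspace invariant under that operator, hence
  also under \<open>T\<close>, which differs from it by a multiple of the identity. The triangle
  inequality gives the bound \<delta> + \<epsilon> there.\<close>

lemma F_shift_subset:
  assumes "linear_operator smul T" "hermitian ip T" and "\<epsilon> \<ge> 0" "\<delta> \<ge> 0"
  shows "F (op_shift T \<delta>) \<epsilon> \<subseteq> F T (\<delta> + \<epsilon>)"
proof (rule subset_F_if_invariant)
  let ?S = "op_shift T \<delta>"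
  note S = linear_operator_shift[OF assms(1), of \<delta>] hermitian_shift[OF assms(2), of \<delta>]
  have app: "op_app T x = op_app ?S x - \<delta> *\<^sub>R x" for x by (simp add: op_shift_def)
  show "F ?S \<epsilon> \<subseteq> op_dom T" using F_dom[OF S] by (auto simp: op_shift_def)
  show "op_app T ` F ?S \<epsilon> \<subseteq> F ?S \<epsilon>"
    unfolding app scale_of_real[symmetric]
    using subspace_F[OF S \<open>\<epsilon> \<ge> 0\<close>] F_invariant[OF S \<open>\<epsilon> \<ge> 0\<close>]
    by (auto intro!: subspace_diff subspace_scale)
  show "norm (op_app T x) \<le> (\<delta> + \<epsilon>) * norm x" if "x \<in> F ?S \<epsilon>" for x
    using norm_triangle_ineq4[of "op_app ?S x" "\<delta> *\<^sub>R x"] F_norm[OF S that] \<open>\<delta> \<ge> 0\<close>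
    unfolding app by (simp add: algebra_simps)
qed (use assms in simp)

end

theorem lemma1:
  fixes smul :: "'k::rc_field \<Rightarrow> 'h::banach \<Rightarrow> 'h"
    and ip :: "'h \<Rightarrow> 'h \<Rightarrow> 'k"
    and A :: "'h operator"
    and \<epsilon> \<delta> l :: real
  assumes "hilbert_space smul ip"
    and "linear_operator smul A" and "closed_operator A" and "hermitian ip A"
    and "\<epsilon> \<ge> 0" and "\<delta> \<ge> 0" and "l \<ge> 0"
  shows "(closed (F A l) \<and> module.subspace smul (F A l) \<and> op_app A ` F A l \<subseteq> F A l) \<and>
    (\<forall>B. bounded_operator smul B \<and> commutes_with B A \<longrightarrow>
       B ` F A l \<subseteq> F A l \<and>
       hilbert_adjoint ip B ` orth_compl ip (F A l) \<subseteq> orth_compl ip (F A l)) \<and>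
    (F (op_shift A \<delta>) \<epsilon> \<subseteq> F A (\<delta> + \<epsilon>) \<and>
     F (op_power A 2) (\<epsilon>\<^sup>2) = F A \<epsilon>)"
proof -
  interpret hilbert_space smul ip by fact
  note A = assms(2,4)
  have B: "B x \<in> F A l" if "bounded_operator smul B" "commutes_with B A" "x \<in> F A l" for B x
    using commutes_with_F[OF A _ that(2) \<open>l \<ge> 0\<close> that(3)] that(1)
    by (simp add: bounded_operator_def)
  \<comment> \<open>For \<open>x\<close> in \<open>F A l\<close>, pairing with the adjoint value
    equals \<open>ip (B x) y\<close>, which is zero because \<open>B x\<close> remains in
    \<open>F A l\<close>.\<close>
  have "hilbert_adjoint ip B y \<in> orth_compl ip (F A l)"
    if "bounded_operator smul B" "commutes_with B A" "y \<in> orth_compl ip (F A l)" for B y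
    using that B by (simp add: orth_compl_def flip: hilbert_adjoint)
  then show ?thesis
    using closed_F[OF A assms(3,7)] subspace_F[OF A assms(7)] F_invariant[OF A assms(7)] B
      F_shift_subset[OF A assms(5,6)] F_square[OF A assms(5)]
    by blast
qed

end
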